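(* Let $L$ be a finite modular semilattice and let $B\subseteq L^n$ be $(\wedge,\vee)$-closed. An element $\mathbf{b}\in B$ is $\vee$-irreducible in $B$ if and only if $\mathbf{b}=\mathbf{e}^i_l$ for some $i\in[n]$ and some $l$ that is a $\vee$-irreducible element of $\pi_i(B)$.
   Context: Semilattices are meet-semilattices; joins may not exist. A semilattice is modular if both of the following hold: every principal ideal is a modular lattice; and $x\vee y\vee z$ exists whenever $x\vee y$, $y\vee z$, $z\vee x$ exist. An element $l$ is $\vee$-irreducible if it is not the minimum and $l=a\vee b$ implies $l=a$ or $l=b$. $L^n$ has the componentwise order, and $\mathbf{b}[i]$ is the $i$-th component. $B\subseteq L^n$ is $(\wedge,\vee)$-closed if both of the following hold: - $B$ is closed under $\wedge$; - $b_1\vee b_2\in B$ whenever $b_1,b_2\in B$ and $b_1\vee b_2$ exists in $L^n$. Further notation: - $\pi_i(B)=\{\mathbf{b}[i]\mid\mathbf{b}\in B\}$, ordered as a subset of $L$. - For $i\in[n]$ and $l\in L$, the base $\mathbf{e}^i_l=\min\{\mathbf{b}\in B\mid\mathbf{b}[i]=l\}$; it is undefined if this set is empty. *)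

theory Defs
  imports "HOL-Library.Lub_Glb"
begin

text \<open>
  A poset is given as a subset \<open>S\<close> of an ordered type, with the induced order; \<open>isLub S A s\<close>
  states that \<open>s\<close> is the least upper bound of \<open>A\<close> within \<open>S\<close>.  Hence ``\<open>a \<or> b\<close> exists
  in \<open>S\<close>'' is \<open>\<exists>s. isLub S {a, b} s\<close>.
\<close>

definition lattice_on :: "'a::order set \<Rightarrow> bool" where
  "lattice_on S \<longleftrightarrow>
     (\<forall>a\<in>S. \<forall>b\<in>S. (\<exists>m. isGlb S {a, b} m) \<and> (\<exists>s. isLub S {a, b} s))"

definition join_in :: "'a::order set \<Rightarrow> 'a \<Rightarrow> 'a \<Rightarrow> 'a" where
  "join_in S a b = (THE s. isLub S {a, b} s)"

definition meet_in :: "'a::order set \<Rightarrow> 'a \<Rightarrow> 'a \<Rightarrow> 'a" where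
  "meet_in S a b = (THE m. isGlb S {a, b} m)"

definition modular_lattice_on :: "'a::order set \<Rightarrow> bool" where
  "modular_lattice_on S \<longleftrightarrow> lattice_on S \<and>
     (\<forall>a\<in>S. \<forall>b\<in>S. \<forall>c\<in>S. a \<le> c \<longrightarrow>
        join_in S a (meet_in S b c) = meet_in S (join_in S a b) c)"

definition modular_semilattice :: "'a::semilattice_inf itself \<Rightarrow> bool" where
  "modular_semilattice (_ :: 'a itself) \<longleftrightarrow>
     (\<forall>x::'a. modular_lattice_on {..x}) \<and>
     (\<forall>x y z :: 'a.
        (\<exists>s. isLub UNIV {x, y} s) \<and> (\<exists>s. isLub UNIV {y, z} s) \<and> (\<exists>s. isLub UNIV {z, x} s) \<longrightarrow>
        (\<exists>s. isLub UNIV {x, y, z} s))"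

definition join_irreducible_in :: "'a::order set \<Rightarrow> 'a \<Rightarrow> bool" where
  "join_irreducible_in S l \<longleftrightarrow> l \<in> S \<and> \<not> (\<forall>x\<in>S. l \<le> x) \<and>
     (\<forall>a\<in>S. \<forall>b\<in>S. isLub S {a, b} l \<longrightarrow> l = a \<or> l = b)"

text \<open>
  \<open>L\<^sup>n\<close> is the function type \<open>'n \<Rightarrow> 'a\<close> with its pointwise order and meet, where \<open>'a\<close> is \<open>L\<close> and
  the finite type \<open>'n\<close> plays the role of the index set \<open>[n]\<close>.
\<close>

definition meet_join_closed :: "('n::finite \<Rightarrow> 'a::semilattice_inf) set \<Rightarrow> bool" where
  "meet_join_closed B \<longleftrightarrow>
     (\<forall>b1\<in>B. \<forall>b2\<in>B. inf b1 b2 \<in> B) \<and>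
     (\<forall>b1\<in>B. \<forall>b2\<in>B. \<forall>s. isLub UNIV {b1, b2} s \<longrightarrow> s \<in> B)"

definition proj :: "'n \<Rightarrow> ('n \<Rightarrow> 'a) set \<Rightarrow> 'a set" where
  "proj i B = {b i | b. b \<in> B}"

text \<open>
  The base \<open>e\<^sup>i\<^sub>l\<close>.  Its value is unspecified when no element of \<open>B\<close> has \<open>i\<close>-th component \<open>l\<close>,
  that is, when \<open>l \<notin> proj i B\<close>.
\<close>

definition base :: "('n::finite \<Rightarrow> 'a::order) set \<Rightarrow> 'n \<Rightarrow> 'a \<Rightarrow> ('n \<Rightarrow> 'a)" where
  "base B i l = (LEAST b. b \<in> B \<and> b i = l)"

end

(* Bases are monotone: base B i l lies below every element of B whose i-th component is
   at least l.  Every b in B is the join of the bases of its components, so an irreducible b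
   is one of these bases; since joins of bounded pairs exist and are computed componentwise,
   a decomposition of base B i l in B and one of l in proj i B induce each other. *)
theory Submission imports Defs begin

lemma isLub_pair_iff:
  "isLub S {a, b} s \<longleftrightarrow> s \<in> S \<and> a \<le> s \<and> b \<le> s \<and> (\<forall>u\<in>S. a \<le> u \<longrightarrow> b \<le> u \<longrightarrow> s \<le> u)"
  by (auto simp: isLub_def leastP_def isUb_def setle_def setge_def)

text \<open>By finiteness the common upper bounds form a finite set, nonempty because of
  \<open>u\<close>; their meet is again an upper bound, hence the least one.\<close>

lemma bounded_pair_has_lub:
  fixes a b u :: "'a::{finite, semilattice_inf}"
  assumes "a \<le> u" "b \<le> u"
  shows "\<exists>s. isLub UNIV {a, b} s"
proof -
  let ?U = "{u. a \<le> u \<and> b \<le> u}"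
  have U: "finite ?U" "?U \<noteq> {}"
    using assms by auto
  have "a \<le> Inf_fin ?U" "b \<le> Inf_fin ?U"
    using U by (auto intro: Inf_fin.boundedI)
  moreover have "Inf_fin ?U \<le> v" if "a \<le> v" "b \<le> v" for v
    using Inf_fin.coboundedI[OF U(1)] that by simp
  ultimately show ?thesis
    unfolding isLub_pair_iff by blast
qed

text \<open>Overwriting component \<open>i\<close> of \<open>s\<close> by a common upper bound
  \<open>u\<close> of \<open>x i\<close> and \<open>y i\<close> yields an upper bound of
  \<open>x\<close> and \<open>y\<close>, so leastness of \<open>s\<close> forces
  \<open>s i \<le> u\<close>.\<close>

lemma isLub_funD:
  fixes x y s :: "'n \<Rightarrow> 'a::order"
  assumes "isLub UNIV {x, y} s"
  shows "isLub UNIV {x i, y i} (s i)"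
proof -
  have le: "x \<le> s" "y \<le> s" and least: "\<And>u. x \<le> u \<Longrightarrow> y \<le> u \<Longrightarrow> s \<le> u"
    using assms by (auto simp: isLub_pair_iff)
  have "s i \<le> u" if u: "x i \<le> u" "y i \<le> u" for u
  proof -
    have "x \<le> s(i := u)" "y \<le> s(i := u)"
      using le u unfolding le_fun_def by simp_all
    from le_funD[OF least[OF this], of i] show ?thesis
      by simp
  qed
  with le show ?thesis
    unfolding isLub_pair_iff le_fun_def by blast
qed

text \<open>Since \<open>s\<close> bounds the pair, a join exists in the full power; closure puts it
  into \<open>B\<close>, where it must coincide with \<open>s\<close>.\<close>

lemma isLub_closed_imp_UNIV:
  fixes B :: "('n::finite \<Rightarrow> 'a::{finite, semilattice_inf}) set"
  assumes "meet_join_closed B" "x \<in> B" "y \<in> B" "isLub B {x, y} s"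
  shows "isLub UNIV {x, y} s"
proof -
  have s: "x \<le> s" "y \<le> s"
    using assms(4) unfolding isLub_pair_iff by blast+
  obtain t where t: "isLub UNIV {x, y} t"
    using bounded_pair_has_lub s(1,2) by blast
  with assms(1-3) have "t \<in> B"
    unfolding meet_join_closed_def by blast
  with t assms(4) have "s = t"
    unfolding isLub_pair_iff by (blast intro: order.antisym)
  with t show ?thesis by simp
qed

lemma base_properties:
  fixes B :: "('n::finite \<Rightarrow> 'a::{finite, semilattice_inf}) set"
  assumes B: "meet_join_closed B" and l: "l \<in> proj i B"
  shows base_in: "base B i l \<in> B"
    and base_component: "base B i l i = l"
    and base_le: "\<And>c. c \<in> B \<Longrightarrow> l \<le> c i \<Longrightarrow> base B i l \<le> c"
proof -
  let ?P = "\<lambda>c. c \<in> B \<and> c i = l"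
  \<comment> \<open>Here \<open>d\<close> need not have component \<open>l\<close>, only one above
    it. A minimal \<open>m\<close> of the fibre therefore equals \<open>inf m d\<close> for all such
    \<open>d\<close>, which gives monotonicity and not just leastness in the fibre.\<close>
  have inf_P: "?P (inf c d)" if "?P c" "d \<in> B" "l \<le> d i" for c d
  proof
    show "inf c d \<in> B"
      using B that(1,2) unfolding meet_join_closed_def by blast
    show "inf c d i = l"
      using that(1,3) by (simp add: inf_absorb1)
  qed
  have "\<exists>c. ?P c"
    using l by (auto simp: proj_def)
  then obtain m where m: "?P m" "\<And>c. ?P c \<Longrightarrow> c \<le> m \<Longrightarrow> c = m"
    using finite_has_minimal[OF finite, of "{c. ?P c}"] by blast
  have least: "m \<le> d" if "d \<in> B" "l \<le> d i" for d
    using m(2)[OF inf_P[OF m(1) that] inf_le1] by (metis inf_le2)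
  have eq: "base B i l = m"
    unfolding base_def
  proof (rule Least_equality)
    show "m \<le> c" if "?P c" for c
      using least that by simp
  qed (rule m(1))
  show "base B i l \<in> B" "base B i l i = l" "\<And>c. c \<in> B \<Longrightarrow> l \<le> c i \<Longrightarrow> base B i l \<le> c"
    unfolding eq using m(1) least by blast+
qed

lemma join_irreducible_is_base:
  fixes B :: "('n::finite \<Rightarrow> 'a::{finite, semilattice_inf}) set"
  assumes B: "meet_join_closed B" and irr: "join_irreducible_in B b"
  shows "\<exists>i. b = base B i (b i)"
proof (rule ccontr)
  assume neq: "\<nexists>i. b = base B i (b i)"
  have b: "b \<in> B"
    using irr by (simp add: join_irreducible_in_def)
  then have mem: "b i \<in> proj i B" for i
    by (auto simp: proj_def)
  note base = base_in[OF B mem] base_component[OF B mem] base_le[OF B mem b order_refl]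
  \<comment> \<open>The bases are joined one index at a time: irreducibility keeps each partial join
    different from \<open>b\<close>, which is absurd once \<open>I\<close> contains every
    index.\<close>
  have "\<exists>c\<in>B. c \<le> b \<and> c \<noteq> b \<and> (\<forall>i\<in>I. c i = b i)" for I
    using finite[of I]
  proof induction
    case empty
    \<comment> \<open>Any index, and one exists because types are nonempty, supplies its base as an
      element properly below \<open>b\<close>.\<close>
    show ?case
      using base(1,3) neq by (metis empty_iff)
  next
    case (insert i I)
    then obtain c where c: "c \<in> B" "c \<le> b" "c \<noteq> b" "\<forall>j\<in>I. c j = b j"
      by blast
    let ?e = "base B i (b i)"
    obtain s where s: "isLub UNIV {c, ?e} s"
      using bounded_pair_has_lub[OF c(2) base(3)] by blast
    have sB: "s \<in> B"
      using B s c(1) base(1) unfolding meet_join_closed_def by blast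
    have le: "c \<le> s" "?e \<le> s" "s \<le> b"
      using s c(2) base(3) unfolding isLub_pair_iff by blast+
    have "isLub B {c, ?e} s"
      using s sB unfolding isLub_pair_iff by blast+
    then have "s \<noteq> b"
      using irr c(1,3) base(1) neq unfolding join_irreducible_in_def by metis
    \<comment> \<open>\<open>s j\<close> is squeezed between \<open>c j = b j\<close> (old indices)
      or \<open>?e i = b i\<close> (the new one) and \<open>b j\<close>.\<close>
    moreover have "s j = b j" if "j \<in> insert i I" for j
      using that c(4) le base(2)[of i]
      by (metis antisym insertE le_funD)
    ultimately show ?case
      using sB le(3) by blast
  qed
  from this[of UNIV] show False
    by auto
qed

text \<open>A decomposition of \<open>l\<close> into \<open>a\<close> and \<open>c\<close> lifts to
  one of \<open>base B i l\<close> into the bases of \<open>a\<close> and \<open>c\<close>.\<close>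

lemma join_irreducible_component:
  fixes B :: "('n::finite \<Rightarrow> 'a::{finite, semilattice_inf}) set"
  assumes B: "meet_join_closed B" and l: "l \<in> proj i B"
    and irr: "join_irreducible_in B (base B i l)"
  shows "join_irreducible_in (proj i B) l"
proof -
  note base = base_in[OF B l] base_component[OF B l] base_le[OF B l]
  have "\<not> (\<forall>x\<in>proj i B. l \<le> x)"
  proof
    assume "\<forall>x\<in>proj i B. l \<le> x"
    then have "\<forall>c\<in>B. base B i l \<le> c"
      using base(3) by (auto simp: proj_def)
    with irr show False
      by (simp add: join_irreducible_in_def)
  qed
  moreover have "l = a \<or> l = c"
    if a: "a \<in> proj i B" and c: "c \<in> proj i B" and lub: "isLub (proj i B) {a, c} l" for a c
  proof -
    have le: "a \<le> l" "c \<le> l"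
      using lub unfolding isLub_pair_iff by blast+
    have "base B i a \<le> base B i l" "base B i c \<le> base B i l"
      using base(1,2) le by (auto intro!: base_le[OF B a] base_le[OF B c])
    then obtain s where s: "isLub UNIV {base B i a, base B i c} s" "s \<le> base B i l"
      using bounded_pair_has_lub by (metis UNIV_I isLub_pair_iff)
    have sB: "s \<in> B"
      using B s(1) base_in[OF B a] base_in[OF B c] unfolding meet_join_closed_def by blast
    have "a \<le> s i" "c \<le> s i"
      using isLub_funD[OF s(1), of i]
      unfolding isLub_pair_iff base_component[OF B a] base_component[OF B c] by blast+
    \<comment> \<open>\<open>l\<close> is least only among the upper bounds inside
      \<open>proj i B\<close>, so \<open>s i\<close> must be placed there before the two can be
      compared.\<close>
    moreover have "s i \<in> proj i B"
      using sB by (auto simp: proj_def)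
    ultimately have "l \<le> s i"
      using lub unfolding isLub_pair_iff by blast+
    with s(2) base(3) sB have "s = base B i l"
      by (intro order.antisym) simp_all
    with s(1) base(1) have "isLub B {base B i a, base B i c} (base B i l)"
      unfolding isLub_pair_iff by blast+
    with irr base_in[OF B a] base_in[OF B c]
    have "base B i l = base B i a \<or> base B i l = base B i c"
      unfolding join_irreducible_in_def by blast
    then show ?thesis
      using base(2) base_component[OF B a] base_component[OF B c] by metis
  qed
  ultimately show ?thesis
    using l by (auto simp: join_irreducible_in_def)
qed

lemma join_irreducible_base:
  fixes B :: "('n::finite \<Rightarrow> 'a::{finite, semilattice_inf}) set"
  assumes B: "meet_join_closed B" and irr: "join_irreducible_in (proj i B) l"
  shows "join_irreducible_in B (base B i l)"
proof -
  have l: "l \<in> proj i B"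
    using irr by (simp add: join_irreducible_in_def)
  note base = base_in[OF B l] base_component[OF B l] base_le[OF B l]
  have "\<not> (\<forall>x\<in>B. base B i l \<le> x)"
  proof
    assume "\<forall>x\<in>B. base B i l \<le> x"
    then have "\<forall>x\<in>proj i B. l \<le> x"
      using base(2) by (force simp: proj_def dest: bspec le_funD[of _ _ i])
    with irr show False
      by (simp add: join_irreducible_in_def)
  qed
  moreover have "base B i l = x \<or> base B i l = y"
    if x: "x \<in> B" and y: "y \<in> B" and lub: "isLub B {x, y} (base B i l)" for x y
  proof -
    \<comment> \<open>The join in \<open>B\<close> is first moved to the full power, where joins are
      componentwise; it then restricts to \<open>proj i B\<close> because \<open>l\<close> lies
      there.\<close>
    have "isLub UNIV {x i, y i} l"
      using isLub_funD[OF isLub_closed_imp_UNIV[OF B x y lub], of i] base(2) by simp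
    then have "isLub (proj i B) {x i, y i} l"
      using l unfolding isLub_pair_iff by blast+
    then have "l = x i \<or> l = y i"
      using irr x y by (auto simp: join_irreducible_in_def proj_def)
    \<comment> \<open>The reverse inequalities hold because \<open>x\<close> and \<open>y\<close>
      lie below their join \<open>base B i l\<close>.\<close>
    then have "base B i l \<le> x \<or> base B i l \<le> y"
      using base(3) x y by auto
    then show ?thesis
      using lub unfolding isLub_pair_iff by (blast intro: order.antisym)
  qed
  ultimately show ?thesis
    using base(1) by (auto simp: join_irreducible_in_def)
qed

theorem theorem3p6:
  fixes B :: "('n::finite \<Rightarrow> 'a::{finite, semilattice_inf}) set"
  assumes "modular_semilattice TYPE('a)"
    and "meet_join_closed B"
    and "b \<in> B"
  shows "join_irreducible_in B b \<longleftrightarrow>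
    (\<exists>i l. join_irreducible_in (proj i B) l \<and> b = base B i l)"
proof
  assume irr: "join_irreducible_in B b"
  then obtain i where "b = base B i (b i)"
    using join_irreducible_is_base assms(2) by blast
  moreover have "b i \<in> proj i B"
    using assms(3) by (auto simp: proj_def)
  ultimately show "\<exists>i l. join_irreducible_in (proj i B) l \<and> b = base B i l"
    using join_irreducible_component[OF assms(2)] irr by metis
qed (use join_irreducible_base assms(2) in blast)

end
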